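(* Let $\Sigma=(\widetilde{\mathbf{x}},\Lambda,\widetilde{B})$ be an acyclic quantum seed with principal coefficients, with indices ordered so that $b_{ij}\ge 0$ for all $n\ge i>j\ge 1$. For any $j\in[1,n]$ and $1\le k<j$ we have $$x_j^{(n)}x_k-q^{-\lambda_{jk}}x_kx_j^{(n)}=f_{k,1}^{(j)},\qquad f_{k,1}^{(j)}=M_{k,1}^{(j)}\,(X^{(j-1)})^{\sum_{v=j+1}^n b_{vj}\mathbf{e}_v+\mathbf{e}_{n+j}},$$ where $$M_{k,1}^{(j)}=\sum_{t=k}^{j-1}\Big(q^{M_j-\lambda_{jk}+\lambda_{n+j,k}+\sum_{v=j+1}^n b_{vj}\lambda_{vk}+\sum_{r=t+1}^{j-1}b_{rj}\lambda_{rk}}\prod_{i\in[1,t-1]}(x_i^{(n)})^{-b_{ij}}\cdot f_{k,-b_{tj}}^{(t)}\cdot\prod_{i\in[t+1,j-1]}(x_i^{(n)})^{-b_{ij}}\cdot x_j^{-1}\Big)$$ with products taken in increasing order of $i$, $$f_{k,-b_{tj}}^{(t)}:=\sum_{i=1}^{-b_{tj}}q^{-(i-1)\lambda_{tk}}(x_t^{(n)})^{-b_{tj}-i}f_{k,1}^{(t)}(x_t^{(n)})^{i-1},$$ $f_{k,1}^{(k)}:=x_k^{(n)}x_k-x_kx_k^{(n)}$, and $$M_j=\tfrac12\Big(-\sum_{r=1}^{j-1}\sum_{t=r+1}^{j-1}b_{rj}b_{tj}\lambda_{rt}+\sum_{r=1}^{j-1}b_{rj}\lambda_{rj}+\sum_{r=j+1}^{n}b_{rj}\lambda_{jr}+\lambda_{j,n+j}\Big).$$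 Moreover $M_{k,1}^{(j)}\in\mathbb{ZP}[x_1^{(n)},\dots,x_{j-1}^{(n)},x_{k+1},\dots,x_n]$.
   Context: Notation: $[s,t]=\{s,s+1,\dots,t\}$; $[x]_+=\max(x,0)$, applied entrywise to vectors; $\mathbf{e}_i$ is the $i$-th unit vector. Empty sums are $0$ and empty products are $1$. Quantum seeds. Let $\widetilde{B}=(b_{ij})$ be a $2n\times n$ integer matrix with columns $\mathbf{b}_1,\dots,\mathbf{b}_n$, whose upper $n\times n$ part $B$ is skew-symmetrizable: $DB$ is skew-symmetric for $D=\mathrm{diag}(d_1,\dots,d_n)$ with positive integer $d_j$. "Principal coefficients" means that the lower $n\times n$ part of $\widetilde{B}$ is the identity, i.e. $b_{n+i,j}=\delta_{ij}$. Let $\Lambda=(\lambda_{ij})$ be a skew-symmetric $2n\times 2n$ integer matrix, identified with the bilinear form on $\mathbb{Z}^{2n}$ with $\Lambda(\mathbf{e}_i,\mathbf{e}_j)=\lambda_{ij}$, compatible with $\widetilde{B}$: $\Lambda(\mathbf{b}_j,\mathbf{e}_i)=\delta_{ij}d_j$ for $i\in[1,2n]$, $j\in[1,n]$. The quantum torus $\mathcal{T}$ is the $\mathbb{Z}[q^{\pm 1/2}]$-algebra with basis $\{X^{\mathbf{a}}:\mathbf{a}\in\mathbb{Z}^{2n}\}$ and product $X^{\mathbf{a}}X^{\mathbf{c}}=q^{\Lambda(\mathbf{a},\mathbf{c})/2}X^{\mathbf{a}+\mathbf{c}}$; $\mathcal{F}$ is its skew-field of fractions and $x_i=X^{\mathbf{e}_i}$,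 so $x_ix_j=q^{\lambda_{ij}}x_jx_i$ and $X^{\mathbf{a}}=q^{\frac12\sum_{l<k}a_ka_l\lambda_{kl}}x_1^{a_1}\cdots x_{2n}^{a_{2n}}$. The triple $\Sigma=(\widetilde{\mathbf{x}},\Lambda,\widetilde{B})$ with $\widetilde{\mathbf{x}}=\{x_1,\dots,x_{2n}\}$ is a quantum seed. $\mathbb{ZP}=\mathbb{Z}[q^{\pm1/2}][x_{n+1}^{\pm1},\dots,x_{2n}^{\pm1}]$, a (quasi-commutative) subring of $\mathcal{F}$; $\mathbb{ZP}[y_1,y_2,\dots]$ denotes the subring of $\mathcal{F}$ generated by $\mathbb{ZP}$ and the $y_i$. Mutation. For $k\in[1,n]$, the mutation $\mu_k$ replaces $x_k$ by $x_k'=X^{-\mathbf{e}_k+[\mathbf{b}_k]_+}+X^{-\mathbf{e}_k+[-\mathbf{b}_k]_+}$, replaces $\widetilde{B}$ by $\widetilde{B}'$ with $b'_{ij}=-b_{ij}$ if $i=k$ or $j=k$, and $b'_{ij}=b_{ij}+\frac{|b_{ik}|b_{kj}+b_{ik}|b_{kj}|}{2}$ otherwise, and replaces $\Lambda$ by the skew-symmetric $\Lambda'$ with $\lambda'_{ij}=\lambda_{ij}$ for $i,j\ne k$ and $\lambda'_{kj}=-\lambda_{kj}+\sum_{t}[b_{tk}]_+\lambda_{tj}$ for $j\neq k$. The same rule applies to any seed obtained by mutation, with $X^{\mathbf{a}}$ formed from the variables and form of that seed by the normalized ordered monomial formula above. A seed is acyclic if the directed graph on $[1,n]$ with an edge $i\to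 j$ whenever $b_{ij}>0$ has no oriented cycle; in this case, after reordering, one assumes $b_{ij}\ge0$ for all $i>j$ in $[1,n]$ (so $b_{ij}\le0$ for $i<j$ in $[1,n]$). Projective cluster variables. Put $\Sigma^{(0)}=\Sigma$ and, for $i\in[1,n]$, $\Sigma^{(i)}=(\widetilde{\mathbf{x}}^{(i)},\Lambda^{(i)},\widetilde{B}^{(i)})=\mu_i\cdots\mu_2\mu_1(\Sigma)$ ($\mu_1$ is applied first), with $\widetilde{\mathbf{x}}^{(i)}=\{x_1^{(i)},\dots,x_{2n}^{(i)}\}$ and $\Lambda^{(i)}=(\lambda^{(i)}_{kl})$. The elements $x_1^{(n)},\dots,x_n^{(n)}$ of the cluster of $\Sigma^{(n)}$ are the quantum projective cluster variables. For $\mathbf{a}\in\mathbb{Z}^{2n}$, $(X^{(i)})^{\mathbf{a}}:=q^{\frac12\sum_{l<k}a_ka_l\lambda^{(i)}_{kl}}(x_1^{(i)})^{a_1}(x_2^{(i)})^{a_2}\cdots(x_{2n}^{(i)})^{a_{2n}}$. *)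

theory Defs
  imports Complex_Main "HOL-Algebra.Generated_Rings"
begin

text \<open>
  Conventions. Indices are natural numbers running over \<open>[1,2n]\<close> (exchangeable ones over \<open>[1,n]\<close>);
  values of vectors and matrices outside these ranges are never used. The ambient skew-field is a
  type of class \<open>division_ring\<close>, and the parameter \<open>h\<close> is the central element \<open>q\<^sup>1\<^sup>/\<^sup>2\<close>, so that
  \<open>q\<^sup>m\<close> is written \<open>h powi (2 * m)\<close> and half-integral powers of \<open>q\<close> are integral powers of \<open>h\<close>.
\<close>

definition unit_vec :: "nat \<Rightarrow> nat \<Rightarrow> int" where
  "unit_vec i = (\<lambda>k. if k = i then 1 else 0)"

definition pos_part :: "int \<Rightarrow> int" where
  "pos_part x = max x 0"

definition bilin :: "nat \<Rightarrow> (nat \<Rightarrow> nat \<Rightarrow> int) \<Rightarrow> (nat \<Rightarrow> int) \<Rightarrow> (nat \<Rightarrow> int) \<Rightarrow> int" where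
  "bilin n L a c = (\<Sum>i = 1..2*n. \<Sum>j = 1..2*n. a i * L i j * c j)"

definition skew_symmetric_on :: "nat \<Rightarrow> (nat \<Rightarrow> nat \<Rightarrow> int) \<Rightarrow> bool" where
  "skew_symmetric_on m A \<longleftrightarrow> (\<forall>i\<in>{1..m}. \<forall>j\<in>{1..m}. A i j = - A j i)"

definition compatible :: "nat \<Rightarrow> (nat \<Rightarrow> int) \<Rightarrow> (nat \<Rightarrow> nat \<Rightarrow> int) \<Rightarrow> (nat \<Rightarrow> nat \<Rightarrow> int) \<Rightarrow> bool" where
  "compatible n d L B \<longleftrightarrow>
     (\<forall>i\<in>{1..2*n}. \<forall>j\<in>{1..n}.
        bilin n L (\<lambda>t. B t j) (unit_vec i) = (if i = j then d j else 0))"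

definition principal_coefficients :: "nat \<Rightarrow> (nat \<Rightarrow> nat \<Rightarrow> int) \<Rightarrow> bool" where
  "principal_coefficients n B \<longleftrightarrow>
     (\<forall>i\<in>{1..n}. \<forall>j\<in>{1..n}. B (n + i) j = (if i = j then 1 else 0))"

definition acyclic_exchange :: "nat \<Rightarrow> (nat \<Rightarrow> nat \<Rightarrow> int) \<Rightarrow> bool" where
  "acyclic_exchange n B \<longleftrightarrow> acyclic {(i, j). i \<in> {1..n} \<and> j \<in> {1..n} \<and> B i j > 0}"


section \<open>The quantum torus and its skew-field of fractions\<close>

definition lattice_vecs :: "nat \<Rightarrow> (nat \<Rightarrow> int) set" where
  "lattice_vecs n = {a. \<forall>i. i \<notin> {1..2*n} \<longrightarrow> a i = 0}"

text \<open>The \<open>\<int>[q\<^sup>\<plusminus>\<^sup>1\<^sup>/\<^sup>2]\<close>-span of the elements \<open>X a\<close>; the pair \<open>(m, a)\<close> stands for \<open>q\<^sup>m\<^sup>/\<^sup>2 X\<^sup>a\<close>.\<close>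

definition torus :: "nat \<Rightarrow> 'f::division_ring \<Rightarrow> ((nat \<Rightarrow> int) \<Rightarrow> 'f) \<Rightarrow> 'f set" where
  "torus n h X =
     {\<Sum>(m, a)\<in>S. of_int (c m a) * h powi m * X a | S c.
        finite S \<and> S \<subseteq> UNIV \<times> lattice_vecs n}"

text \<open>
  The type \<open>'f\<close> is the skew-field of fractions of the quantum torus with form \<open>L\<close>, with basis
  elements \<open>X a\<close>. Since the quantum torus is an Ore domain, its skew-field of fractions is unique
  up to isomorphism, and it is characterised as a division ring containing the torus in which every
  element is a fraction \<open>p s\<^sup>-\<^sup>1\<close> of torus elements. Being a \<open>\<int>[q\<^sup>\<plusminus>\<^sup>1\<^sup>/\<^sup>2]\<close>-basis means that the
  elements \<open>q\<^sup>m\<^sup>/\<^sup>2 X\<^sup>a\<close> are linearly independent over the integers.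
\<close>

locale quantum_torus_fractions =
  fixes n :: nat
    and L :: "nat \<Rightarrow> nat \<Rightarrow> int"
    and h :: "'f::division_ring"
    and X :: "(nat \<Rightarrow> int) \<Rightarrow> 'f"
  assumes h_nonzero: "h \<noteq> 0"
    and h_central: "\<And>z. h * z = z * h"
    and X_mult: "\<And>a c. a \<in> lattice_vecs n \<Longrightarrow> c \<in> lattice_vecs n \<Longrightarrow>
                   X a * X c = h powi (bilin n L a c) * X (\<lambda>i. a i + c i)"
    and X_independent: "\<And>S c. finite S \<Longrightarrow> S \<subseteq> UNIV \<times> lattice_vecs n \<Longrightarrow>
                   (\<Sum>(m, a)\<in>S. of_int (c m a) * h powi m * X a) = 0 \<Longrightarrow>
                   (\<forall>(m, a)\<in>S. c m a = (0::int))"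
    and fractions: "\<And>z. \<exists>p\<in>torus n h X. \<exists>s\<in>torus n h X. s \<noteq> 0 \<and> z = p * inverse s"


section \<open>Quantum seeds and mutation\<close>

record 'f qseed =
  var :: "nat \<Rightarrow> 'f"
  lam :: "nat \<Rightarrow> nat \<Rightarrow> int"
  exch :: "nat \<Rightarrow> nat \<Rightarrow> int"

definition monom_of :: "'f::division_ring \<Rightarrow> nat \<Rightarrow> 'f qseed \<Rightarrow> (nat \<Rightarrow> int) \<Rightarrow> 'f" where
  "monom_of h n S a =
     h powi (\<Sum>k = 1..2*n. \<Sum>l = 1..<k. a k * a l * lam S k l) *
     prod_list (map (\<lambda>i. var S i powi a i) [1..<2*n+1])"

definition mutate_var :: "'f::division_ring \<Rightarrow> nat \<Rightarrow> nat \<Rightarrow> 'f qseed \<Rightarrow> 'f" where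
  "mutate_var h n k S =
     monom_of h n S (\<lambda>i. - unit_vec k i + pos_part (exch S i k)) +
     monom_of h n S (\<lambda>i. - unit_vec k i + pos_part (- exch S i k))"

definition mutate_exch :: "nat \<Rightarrow> (nat \<Rightarrow> nat \<Rightarrow> int) \<Rightarrow> nat \<Rightarrow> nat \<Rightarrow> int" where
  "mutate_exch k B i j =
     (if i = k \<or> j = k then - B i j
      else B i j + (\<bar>B i k\<bar> * B k j + B i k * \<bar>B k j\<bar>) div 2)"

text \<open>The second branch is the first one transported by skew-symmetry.\<close>

definition mutate_lam :: "nat \<Rightarrow> nat \<Rightarrow> (nat \<Rightarrow> nat \<Rightarrow> int) \<Rightarrow> (nat \<Rightarrow> nat \<Rightarrow> int) \<Rightarrow> nat \<Rightarrow> nat \<Rightarrow> int" where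
  "mutate_lam n k B L i j =
     (if i = k \<and> j \<noteq> k then - L k j + (\<Sum>t = 1..2*n. pos_part (B t k) * L t j)
      else if i \<noteq> k \<and> j = k then - (- L k i + (\<Sum>t = 1..2*n. pos_part (B t k) * L t i))
      else if i = k \<and> j = k then 0
      else L i j)"

definition mutate :: "'f::division_ring \<Rightarrow> nat \<Rightarrow> nat \<Rightarrow> 'f qseed \<Rightarrow> 'f qseed" where
  "mutate h n k S =
     \<lparr> var = (var S)(k := mutate_var h n k S),
       lam = mutate_lam n k (exch S) (lam S),
       exch = mutate_exch k (exch S) \<rparr>"

text \<open>\<open>iter_seed h n S i\<close> is \<open>\<mu>\<^sub>i \<dots> \<mu>\<^sub>2 \<mu>\<^sub>1 (S)\<close>.\<close>

fun iter_seed :: "'f::division_ring \<Rightarrow> nat \<Rightarrow> 'f qseed \<Rightarrow> nat \<Rightarrow> 'f qseed" where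
  "iter_seed h n S 0 = S"
| "iter_seed h n S (Suc i) = mutate h n (Suc i) (iter_seed h n S i)"

definition proj_var :: "'f::division_ring \<Rightarrow> nat \<Rightarrow> 'f qseed \<Rightarrow> nat \<Rightarrow> 'f" where
  "proj_var h n S j = var (iter_seed h n S n) j"

definition initial_seed ::
  "((nat \<Rightarrow> int) \<Rightarrow> 'f) \<Rightarrow> (nat \<Rightarrow> nat \<Rightarrow> int) \<Rightarrow> (nat \<Rightarrow> nat \<Rightarrow> int) \<Rightarrow> 'f qseed" where
  "initial_seed X L B = \<lparr> var = (\<lambda>i. X (unit_vec i)), lam = L, exch = B \<rparr>"


section \<open>The elements \<open>f\<close> and \<open>M\<close>\<close>

text \<open>Twice the half-integer \<open>M\<^sub>j\<close>.\<close>

definition two_M :: "nat \<Rightarrow> (nat \<Rightarrow> nat \<Rightarrow> int) \<Rightarrow> (nat \<Rightarrow> nat \<Rightarrow> int) \<Rightarrow> nat \<Rightarrow> int" where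
  "two_M n L B j =
     - (\<Sum>r = 1..j-1. \<Sum>t = r+1..j-1. B r j * B t j * L r t)
     + (\<Sum>r = 1..j-1. B r j * L r j)
     + (\<Sum>r = j+1..n. B r j * L j r)
     + L j (n + j)"

text \<open>The exponent \<open>\<Sum>\<^sub>v\<^sub>>\<^sub>j b\<^sub>v\<^sub>j e\<^sub>v + e\<^sub>n\<^sub>+\<^sub>j\<close>.\<close>

definition tail_exponent :: "nat \<Rightarrow> (nat \<Rightarrow> nat \<Rightarrow> int) \<Rightarrow> nat \<Rightarrow> nat \<Rightarrow> int" where
  "tail_exponent n B j = (\<lambda>i. (\<Sum>v = j+1..n. B v j * unit_vec v i) + unit_vec (n + j) i)"

text \<open>
  \<open>f_pow h n S k t m\<close> is \<open>f\<^sub>k\<^sub>,\<^sub>m\<close> with upper index \<open>t\<close>, \<open>f_one h n S k j\<close> is \<open>f\<^sub>k\<^sub>,\<^sub>1\<close> with upper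
  index \<open>j\<close> (meaningful for \<open>k \<le> j\<close>), and \<open>M_one h n S k j\<close> is \<open>M\<^sub>k\<^sub>,\<^sub>1\<close> with upper index \<open>j\<close>.
  The recursion is on the upper index, starting from the commutator at \<open>j = k\<close>. In \<open>M_one\<close> the
  integer \<open>-b\<^sub>t\<^sub>j\<close> is nonnegative by the ordering of the indices, so that \<open>nat\<close> loses nothing.
\<close>

function (sequential)
  M_one :: "'f::division_ring \<Rightarrow> nat \<Rightarrow> 'f qseed \<Rightarrow> nat \<Rightarrow> nat \<Rightarrow> 'f" and
  f_one :: "'f::division_ring \<Rightarrow> nat \<Rightarrow> 'f qseed \<Rightarrow> nat \<Rightarrow> nat \<Rightarrow> 'f" and
  f_pow :: "'f::division_ring \<Rightarrow> nat \<Rightarrow> 'f qseed \<Rightarrow> nat \<Rightarrow> nat \<Rightarrow> nat \<Rightarrow> 'f"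
where
  "M_one h n S k j =
     (\<Sum>t\<in>{k..<j}.
        h powi (two_M n (lam S) (exch S) j +
                2 * (- lam S j k + lam S (n + j) k
                     + (\<Sum>v = j+1..n. exch S v j * lam S v k)
                     + (\<Sum>r = t+1..j-1. exch S r j * lam S r k))) *
        prod_list (map (\<lambda>i. proj_var h n S i powi (- exch S i j)) [1..<t]) *
        f_pow h n S k t (nat (- exch S t j)) *
        prod_list (map (\<lambda>i. proj_var h n S i powi (- exch S i j)) [t+1..<j]) *
        inverse (var S j))"
| "f_one h n S k j =
     (if j = k then proj_var h n S k * var S k - var S k * proj_var h n S k
      else if k < j then
        M_one h n S k j * monom_of h n (iter_seed h n S (j - 1)) (tail_exponent n (exch S) j)
      else 0)"
| "f_pow h n S k t m =
     (\<Sum>i = 1..m. h powi (- 2 * (int i - 1) * lam S t k) *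
        proj_var h n S t ^ (m - i) * f_one h n S k t * proj_var h n S t ^ (i - 1))"
  by pat_completeness auto
termination
  by (relation "measure (\<lambda>x. case x of
        Inl (h, n, S, k, j) \<Rightarrow> 3 * j
      | Inr (Inl (h, n, S, k, j)) \<Rightarrow> 3 * j + 1
      | Inr (Inr (h, n, S, k, t, m)) \<Rightarrow> 3 * t + 2)") auto

declare M_one.simps [simp del] f_one.simps [simp del] f_pow.simps [simp del]


section \<open>Generated subrings\<close>

definition ring_of_type :: "'f::ring_1 ring" where
  "ring_of_type = \<lparr> carrier = UNIV, mult = (*), one = 1, zero = 0, add = (+) \<rparr>"

definition gen_subring :: "'f::division_ring set \<Rightarrow> 'f set" where
  "gen_subring G = generate_ring ring_of_type G"

definition ZP :: "'f::division_ring \<Rightarrow> nat \<Rightarrow> 'f qseed \<Rightarrow> 'f set" where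
  "ZP h n S = gen_subring ({h, inverse h} \<union> var S ` {n+1..2*n} \<union> (\<lambda>i. inverse (var S i)) ` {n+1..2*n})"

end

theory Submission
  imports Defs
begin

text \<open>
  The ordering of the indices makes vertex \<open>j\<close> a sink of the seed that is mutated at \<open>j\<close>. Therefore
  each mutation only flips signs in the matrix and the form (\<open>exch_seed_at\<close>, \<open>lam_seed_at\<close>), and the
  projective variable \<open>px j\<close> is the sum of \<open>x\<^sub>j\<^sup>-\<^sup>1\<close> and of one explicit ordered monomial, up to a power
  of \<open>h\<close> the product of powers of \<open>px 1, \<dots>, px (j - 1)\<close>, then \<open>x\<^sub>j\<^sup>-\<^sup>1\<close>, then powers of initial
  variables of larger index (\<open>exchange_relation\<close>).

  The commutator of \<open>px j\<close> with \<open>x\<^sub>k\<close>, twisted by the power of \<open>q\<close> that \<open>x\<^sub>j\<^sup>-\<^sup>1\<close> picks up, kills the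
  summand \<open>x\<^sub>j\<^sup>-\<^sup>1\<close>. On the monomial it can be expanded by a twisted Leibniz rule
  (\<open>twisted_comm_mult\<close>), because compatibility of the form with the matrix says that the twists of
  the factors add up to the right total. The initial variables do not contribute, nor do the
  factors \<open>px t\<close> with \<open>t < k\<close>, which commute with \<open>x\<^sub>k\<close> up to a power of \<open>q\<close> by induction
  (\<open>px_x_comm\<close>). What remains are the commutators of powers of \<open>px t\<close> with \<open>k \<le> t < j\<close>: these are
  the elements \<open>f_pow\<close>, by the Leibniz rule for a power, and so the expansion is the recursion
  that defines \<open>M_one\<close> and \<open>f_one\<close> (\<open>f_one_eq_comm\<close>).

  For the membership, the only obstacle is the trailing \<open>x\<^sub>j\<^sup>-\<^sup>1\<close>. The summand of index \<open>t\<close> is nonzero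
  only if \<open>b\<^sub>t\<^sub>j < 0\<close>; then \<open>b\<^sub>j\<^sub>t > 0\<close>, and the monomial of initial variables that ends
  \<open>f_one\<close> at \<open>t\<close> contains \<open>x\<^sub>j\<close>, which cancels it (\<open>tail_absorbs_inverse\<close>). At the
  start \<open>t = k\<close> of the recursion this needs that the commutator of \<open>px k\<close> with \<open>x\<^sub>k\<close> is free of
  \<open>x\<^sub>k\<close> and ends in the same kind of monomial (\<open>diagonal_commutator_factors\<close>).
\<close>

section \<open>Closure properties of generated subrings\<close>

lemma ring_ring_of_type: "ring (ring_of_type :: 'f::ring_1 ring)"
  unfolding ring_of_type_def
  by unfold_locales (auto simp: algebra_simps Units_def intro: exI[of _ "- x" for x])

lemma ring_of_type_a_inv: "\<ominus>\<^bsub>ring_of_type\<^esub> x = - (x :: 'f::ring_1)"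
proof -
  interpret ring "ring_of_type :: 'f ring" by (rule ring_ring_of_type)
  show ?thesis by (rule minus_equality) (simp_all add: ring_of_type_def)
qed

lemma gen_subring_base: "z \<in> G \<Longrightarrow> z \<in> gen_subring G"
  unfolding gen_subring_def by (rule generate_ring.incl)

lemma gen_subring_one: "1 \<in> gen_subring G"
  using generate_ring.one[of ring_of_type G] by (simp add: gen_subring_def ring_of_type_def)

lemma gen_subring_add: "z \<in> gen_subring G \<Longrightarrow> w \<in> gen_subring G \<Longrightarrow> z + w \<in> gen_subring G"
  using generate_ring.eng_add[of z ring_of_type G w] by (simp add: gen_subring_def ring_of_type_def)

lemma gen_subring_mult: "z \<in> gen_subring G \<Longrightarrow> w \<in> gen_subring G \<Longrightarrow> z * w \<in> gen_subring G"
  using generate_ring.eng_mult[of z ring_of_type G w] by (simp add: gen_subring_def ring_of_type_def)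

lemma gen_subring_uminus: "z \<in> gen_subring G \<Longrightarrow> - z \<in> gen_subring G"
  using generate_ring.a_inv[of z ring_of_type G] by (simp add: gen_subring_def ring_of_type_a_inv)

lemma gen_subring_diff: "z \<in> gen_subring G \<Longrightarrow> w \<in> gen_subring G \<Longrightarrow> z - w \<in> gen_subring G"
  using gen_subring_add[of z G "- w"] gen_subring_uminus[of w G] by simp

lemma gen_subring_zero: "0 \<in> gen_subring G"
  using gen_subring_diff[OF gen_subring_one gen_subring_one] by simp

lemma gen_subring_sum: "(\<And>i. i \<in> I \<Longrightarrow> f i \<in> gen_subring G) \<Longrightarrow> sum f I \<in> gen_subring G"
  by (induction I rule: infinite_finite_induct) (simp_all add: gen_subring_zero gen_subring_add)

lemma gen_subring_power: "z \<in> gen_subring G \<Longrightarrow> z ^ m \<in> gen_subring G"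
  by (induction m) (simp_all add: gen_subring_one gen_subring_mult)

lemma gen_subring_powi:
  assumes "z \<in> gen_subring G" "m \<ge> 0 \<or> inverse z \<in> gen_subring G"
  shows "z powi m \<in> gen_subring G"
  using assms gen_subring_power[of z G "nat m"] gen_subring_power[of "inverse z" G "nat (- m)"]
  by (cases "m \<ge> 0") (auto simp: power_int_def)

lemma gen_subring_prod_list:
  "(\<And>i. i \<in> set is \<Longrightarrow> f i \<in> gen_subring G) \<Longrightarrow> prod_list (map f is) \<in> gen_subring G"
  by (induction "is") (simp_all add: gen_subring_one gen_subring_mult)

lemmas gen_subring_closed =
  gen_subring_mult gen_subring_diff gen_subring_power gen_subring_sum gen_subring_prod_list

lemma gen_subring_mono:
  assumes "G \<subseteq> H" shows "gen_subring G \<subseteq> gen_subring H"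
proof
  fix z assume "z \<in> gen_subring G"
  then show "z \<in> gen_subring H" unfolding gen_subring_def
    by (induction rule: generate_ring.induct) (use assms in \<open>auto intro: generate_ring.intros\<close>)
qed


section \<open>Commutators twisted by a central unit\<close>

locale central_unit =
  fixes h :: "'f::division_ring"
  assumes h_nonzero: "h \<noteq> 0"
    and h_central: "h * z = z * h"
begin

definition twisted_comm :: "int \<Rightarrow> 'f \<Rightarrow> 'f \<Rightarrow> 'f" where
  "twisted_comm e z y = z * y - h powi e * y * z"

lemma powi_h_commute: "z * h powi m = h powi m * z"
proof -
  have nonneg: "z * h ^ p = h ^ p * z" for p z
    by (induction p) (simp_all add: mult.assoc h_central, metis h_central mult.assoc)
  have "z * inverse (h ^ p) = inverse (h ^ p) * z" for p
    using nonneg[of z p] h_nonzero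
    by (metis (no_types, lifting) mult.assoc left_inverse right_inverse mult_1_left mult_1_right power_not_zero)
  then show ?thesis
    using nonneg by (auto simp: power_int_def power_inverse)
qed

lemma powi_h_left_commute: "z * (h powi m * w) = h powi m * (z * w)"
  by (metis mult.assoc powi_h_commute)

lemma powi_h_add: "h powi (a + b) = h powi a * h powi b"
  by (rule power_int_add) (simp add: h_nonzero)

lemma powi_h_mult_assoc: "h powi a * (h powi b * w) = h powi (a + b) * w"
  by (simp add: powi_h_add mult.assoc)

text \<open>The twisted commutator with a fixed \<open>y\<close> is a skew derivation, the twists adding up along a
  product. All expansions of commutators below are instances of this Leibniz rule.\<close>

lemma twisted_comm_mult:
  "twisted_comm (a + b) (z * w) y = z * twisted_comm b w y + h powi b * twisted_comm a z y * w"
proof -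
  have "z * (h powi b * (y * w)) = h powi b * (z * (y * w))"
    by (rule powi_h_left_commute)
  moreover have "h powi b * (h powi a * (y * (z * w))) = h powi (a + b) * (y * (z * w))"
    by (simp add: powi_h_mult_assoc add.commute)
  ultimately show ?thesis
    by (simp add: twisted_comm_def algebra_simps)
qed

lemma twisted_comm_add:
  "twisted_comm e (z + w) y = twisted_comm e z y + twisted_comm e w y"
  by (simp add: twisted_comm_def algebra_simps)

lemma twisted_comm_one [simp]: "twisted_comm 0 1 y = 0"
  by (simp add: twisted_comm_def)

lemma twisted_comm_powi_h [simp]: "twisted_comm 0 (h powi m) y = 0"
  by (simp add: twisted_comm_def powi_h_commute)

lemma twisted_comm_scale: "twisted_comm e (h powi m * z) y = h powi m * twisted_comm e z y"
  using twisted_comm_mult[of 0 e "h powi m" z y] by simp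

lemma twisted_comm_mult_zero:
  "twisted_comm a z y = 0 \<Longrightarrow> twisted_comm b w y = 0 \<Longrightarrow> twisted_comm (a + b) (z * w) y = 0"
  by (simp add: twisted_comm_mult)

lemma twisted_comm_zeroD: "twisted_comm e z y = 0 \<Longrightarrow> z * y = h powi e * y * z"
  by (simp add: twisted_comm_def)

lemma twisted_comm_power:
  "twisted_comm (int m * e) (z ^ m) y =
     (\<Sum>i = 1..m. h powi ((int i - 1) * e) * z ^ (m - i) * twisted_comm e z y * z ^ (i - 1))"
proof (induction m)
  case 0
  then show ?case by simp
next
  case (Suc m)
  have "z * (\<Sum>i = 1..m. h powi ((int i - 1) * e) * z ^ (m - i) * twisted_comm e z y * z ^ (i - 1))
      = (\<Sum>i = 1..m. h powi ((int i - 1) * e) * z ^ (Suc m - i) * twisted_comm e z y * z ^ (i - 1))"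
    unfolding sum_distrib_left
    by (rule sum.cong) (simp_all add: powi_h_left_commute Suc_diff_le mult.assoc)
  moreover have "int (Suc m) * e = e + int m * e" by (simp add: algebra_simps)
  ultimately show ?case
    by (simp add: twisted_comm_mult Suc)
qed

lemma twisted_comm_power_zero:
  "twisted_comm e z y = 0 \<Longrightarrow> twisted_comm (int m * e) (z ^ m) y = 0"
  by (simp add: twisted_comm_power)

lemma twisted_comm_inverse_zero:
  assumes "twisted_comm e z y = 0" "z \<noteq> 0"
  shows "twisted_comm (- e) (inverse z) y = 0"
proof -
  have "0 = twisted_comm (e + - e) (z * inverse z) y" using assms(2) by simp
  also have "\<dots> = z * twisted_comm (- e) (inverse z) y"
    using assms(1) by (simp only: twisted_comm_mult) simp
  finally show ?thesis using assms(2) by simp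
qed

lemma twisted_comm_powi_zero:
  assumes "twisted_comm e z y = 0" "z \<noteq> 0 \<or> m \<ge> 0"
  shows "twisted_comm (m * e) (z powi m) y = 0"
proof (cases "m \<ge> 0")
  case True
  then show ?thesis
    using twisted_comm_power_zero[OF assms(1), of "nat m"] by (simp add: power_int_def)
next
  case False
  then show ?thesis
    using twisted_comm_power_zero[OF twisted_comm_inverse_zero[OF assms(1)], of "nat (- m)"] assms(2)
    by (simp add: power_int_def)
qed

text \<open>Moving \<open>y\<close> leftwards through the product, it picks up the twists of the factors that it has
  already passed, those to the right of the factor where the commutator is taken.\<close>

lemma twisted_comm_prod_list:
  assumes "a \<le> b"
  shows "twisted_comm (\<Sum>i = a..<b. e i) (prod_list (map f [a..<b])) y =
     (\<Sum>t = a..<b. h powi (\<Sum>r = t+1..<b. e r) * prod_list (map f [a..<t]) *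
        twisted_comm (e t) (f t) y * prod_list (map f [t+1..<b]))"
  using assms
proof (induction b rule: dec_induct)
  case base
  then show ?case by simp
next
  case (step b)
  have split: "prod_list (map f [t+1..<Suc b]) = prod_list (map f [t+1..<b]) * f b" if "t < b" for t
    using that by simp
  have "h powi e b * (\<Sum>t = a..<b. h powi (\<Sum>r = t+1..<b. e r) * prod_list (map f [a..<t]) *
        twisted_comm (e t) (f t) y * prod_list (map f [t+1..<b])) * f b
     = (\<Sum>t = a..<b. h powi (\<Sum>r = t+1..<Suc b. e r) * prod_list (map f [a..<t]) *
        twisted_comm (e t) (f t) y * prod_list (map f [t+1..<Suc b]))"
    unfolding sum_distrib_left sum_distrib_right
  proof (rule sum.cong, simp)
    fix t assume "t \<in> {a..<b}"
    then have "t < b" by simp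
    then have "(\<Sum>r = t+1..<Suc b. e r) = e b + (\<Sum>r = t+1..<b. e r)" by simp
    then show "h powi e b * (h powi (\<Sum>r = t+1..<b. e r) * prod_list (map f [a..<t]) *
        twisted_comm (e t) (f t) y * prod_list (map f [t+1..<b])) * f b =
        h powi (\<Sum>r = t+1..<Suc b. e r) * prod_list (map f [a..<t]) *
        twisted_comm (e t) (f t) y * prod_list (map f [t+1..<Suc b])"
      by (simp only: split[OF \<open>t < b\<close>] powi_h_add mult.assoc)
  qed
  with step show ?case by (simp add: twisted_comm_mult)
qed

lemma twisted_comm_prod_list_zero:
  assumes "a \<le> b" "\<And>i. i \<in> {a..<b} \<Longrightarrow> twisted_comm (e i) (f i) y = 0"
  shows "twisted_comm (\<Sum>i = a..<b. e i) (prod_list (map f [a..<b])) y = 0"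
  using assms by (simp add: twisted_comm_prod_list)

end

sublocale quantum_torus_fractions \<subseteq> central_unit h
  by unfold_locales (rule h_nonzero, rule h_central)


section \<open>Mutating an acyclic seed at successive sinks\<close>

lemma sum_split_at:
  fixes f :: "nat \<Rightarrow> 'a::comm_monoid_add"
  assumes "1 \<le> j" "j < m"
  shows "sum f {1..<m} = sum f {1..<j} + (f j + sum f {j+1..<m})"
  using sum.atLeastLessThan_concat[of 1 j m f] sum.atLeast_Suc_lessThan[of j m f] assms by simp

lemma sum_triangle_swap:
  fixes f :: "nat \<Rightarrow> nat \<Rightarrow> 'a::comm_monoid_add"
  shows "(\<Sum>r = 1..<j. \<Sum>t = r+1..<j. f r t) = (\<Sum>t = 1..<j. \<Sum>r = 1..<t. f r t)"
  unfolding sum.Sigma[OF finite_atLeastLessThan ballI[OF finite_atLeastLessThan]]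
  by (rule sum.reindex_bij_witness[of _ "\<lambda>(a, b). (b, a)" "\<lambda>(a, b). (b, a)"]) auto

lemma sum_skew_form_zero:
  fixes u :: "nat \<Rightarrow> int"
  assumes "\<And>r s. r \<in> A \<Longrightarrow> s \<in> A \<Longrightarrow> F r s = - F s r"
  shows "(\<Sum>r\<in>A. \<Sum>s\<in>A. u r * u s * F r s) = 0"
proof -
  have "(\<Sum>r\<in>A. \<Sum>s\<in>A. u r * u s * F r s) = (\<Sum>s\<in>A. \<Sum>r\<in>A. u r * u s * F r s)"
    by (rule sum.swap)
  also have "\<dots> = - (\<Sum>s\<in>A. \<Sum>r\<in>A. u s * u r * F s r)"
    unfolding sum_negf[symmetric]
  proof (intro sum.cong refl)
    fix s r assume "s \<in> A" "r \<in> A"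
    then have "F r s = - F s r" by (intro assms)
    then show "u r * u s * F r s = - (u s * u r * F s r)" by simp
  qed
  finally show ?thesis by simp
qed

locale ordered_principal_seed = quantum_torus_fractions n L h X
  for n :: nat and L :: "nat \<Rightarrow> nat \<Rightarrow> int" and h :: "'f::division_ring"
    and X :: "(nat \<Rightarrow> int) \<Rightarrow> 'f" +
  fixes B :: "nat \<Rightarrow> nat \<Rightarrow> int" and d :: "nat \<Rightarrow> int"
  assumes d_pos: "\<forall>i\<in>{1..n}. d i > 0"
    and skew_symmetrizable: "skew_symmetric_on n (\<lambda>i j. d i * B i j)"
    and principal: "principal_coefficients n B"
    and L_skew: "skew_symmetric_on (2 * n) L"
    and compat: "compatible n d L B"
    and ordered: "\<forall>i\<in>{1..n}. \<forall>j\<in>{1..n}. i > j \<longrightarrow> B i j \<ge> 0"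
begin

abbreviation x :: "nat \<Rightarrow> 'f" where
  "x i \<equiv> X (unit_vec i)"

abbreviation seed_at :: "nat \<Rightarrow> 'f qseed" where
  "seed_at \<equiv> iter_seed h n (initial_seed X L B)"

abbreviation px :: "nat \<Rightarrow> 'f" where
  "px \<equiv> proj_var h n (initial_seed X L B)"

lemma L_swap: "a \<in> {1..2*n} \<Longrightarrow> b \<in> {1..2*n} \<Longrightarrow> L a b = - L b a"
  using L_skew unfolding skew_symmetric_on_def by blast

lemma L_self: "a \<in> {1..2*n} \<Longrightarrow> L a a = 0"
  using L_swap[of a a] by simp

lemma B_frozen: "i \<in> {1..n} \<Longrightarrow> j \<in> {1..n} \<Longrightarrow> B (n + i) j = (if i = j then 1 else 0)"
  using principal by (simp add: principal_coefficients_def)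

lemma B_swap: "i \<in> {1..n} \<Longrightarrow> j \<in> {1..n} \<Longrightarrow> d i * B i j = - (d j * B j i)"
  using skew_symmetrizable unfolding skew_symmetric_on_def by blast

lemma B_self: "i \<in> {1..n} \<Longrightarrow> B i i = 0"
  using B_swap[of i i] d_pos by fastforce

lemma B_below:
  assumes "i \<in> {1..2*n}" "j \<in> {1..n}" "j < i" shows "B i j \<ge> 0"
proof (cases "i \<le> n")
  case True
  then show ?thesis using assms ordered by simp
next
  case False
  then have "i - n \<in> {1..n}" using assms by auto
  with False show ?thesis using assms B_frozen[of "i - n" j] by simp
qed

lemma B_above_neg_iff:
  assumes "i \<in> {1..n}" "j \<in> {1..n}" shows "B i j < 0 \<longleftrightarrow> B j i > 0"
proof -
  have "d i > 0" "d j > 0" using assms d_pos by auto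
  have "B i j < 0 \<longleftrightarrow> d i * B i j < 0"
    using \<open>d i > 0\<close> by (simp add: mult_less_0_iff)
  also have "\<dots> \<longleftrightarrow> d j * B j i > 0" using B_swap[OF assms] by simp
  also have "\<dots> \<longleftrightarrow> B j i > 0" using \<open>d j > 0\<close> by (simp add: zero_less_mult_iff)
  finally show ?thesis .
qed

lemma B_above:
  assumes "j \<in> {1..n}" "1 \<le> i" "i \<le> j" shows "B i j \<le> 0"
proof -
  have "B j i \<ge> 0" using assms ordered B_self[of j] by (cases "i = j") auto
  then show ?thesis using B_above_neg_iff[of j i] assms by auto
qed

lemma column_pairing:
  assumes "i \<in> {1..2*n}" "j \<in> {1..n}"
  shows "(\<Sum>t = 1..2*n. B t j * L t i) = (if i = j then d j else 0)"
proof -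
  have "bilin n L (\<lambda>t. B t j) (unit_vec i) = (\<Sum>t = 1..2*n. B t j * L t i)"
    unfolding bilin_def unit_vec_def using assms by (intro sum.cong) (auto simp: if_distrib cong: if_cong)
  with compat assms show ?thesis by (auto simp: compatible_def)
qed

lemma x_mult: "a \<in> {1..2*n} \<Longrightarrow> b \<in> {1..2*n} \<Longrightarrow> x a * x b = h powi (2 * L a b) * x b * x a"
proof -
  assume ab: "a \<in> {1..2*n}" "b \<in> {1..2*n}"
  have mem: "unit_vec i \<in> lattice_vecs n" if "i \<in> {1..2*n}" for i
    using that by (auto simp: lattice_vecs_def unit_vec_def)
  have form: "bilin n L (unit_vec i) (unit_vec l) = L i l" if "i \<in> {1..2*n}" "l \<in> {1..2*n}" for i l
  proof -
    have "bilin n L (unit_vec i) (unit_vec l) = (\<Sum>r = 1..2*n. unit_vec i r * L r l)"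
      unfolding bilin_def using that
      by (intro sum.cong) (auto simp: unit_vec_def if_distrib cong: if_cong)
    also have "\<dots> = (\<Sum>r = 1..2*n. if r = i then L r l else 0)"
      by (rule sum.cong) (auto simp: unit_vec_def)
    finally show ?thesis using that by simp
  qed
  have "x a * x b = h powi L a b * X (\<lambda>i. unit_vec a i + unit_vec b i)"
    using ab by (simp add: X_mult mem form)
  moreover have "x b * x a = h powi (- L a b) * X (\<lambda>i. unit_vec a i + unit_vec b i)"
    using ab L_swap[of b a] by (simp add: X_mult mem form add.commute)
  ultimately show ?thesis
    by (simp add: mult.assoc powi_h_mult_assoc)
qed

lemma x_nonzero:
  assumes "a \<in> {1..2*n}" shows "x a \<noteq> 0"
proof
  assume "x a = 0"
  moreover have "unit_vec a \<in> lattice_vecs n"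
    using assms by (auto simp: lattice_vecs_def unit_vec_def)
  ultimately show False
    using X_independent[of "{(0, unit_vec a)}" "\<lambda>_ _. 1"] by simp
qed

text \<open>The sequence of mutations acts on the exchange matrix and on the form by conjugation with the
  diagonal matrix of these signs.\<close>

definition flip :: "nat \<Rightarrow> nat \<Rightarrow> int" where
  "flip i a = (if a \<le> i then - 1 else 1)"

text \<open>Vertex \<open>i + 1\<close> is a sink of the \<open>i\<close>-th seed: its column is nonnegative and its row is
  nonpositive. Hence the correction terms of matrix mutation cancel, and only the signs in the row
  and the column of the vertex change.\<close>

lemma exch_seed_at:
  assumes "i \<le> n" "a \<in> {1..2*n}" "b \<in> {1..n}"
  shows "exch (seed_at i) a b = flip i a * flip i b * B a b"
  using assms
proof (induction i arbitrary: a b)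
  case 0
  then show ?case by (simp add: initial_seed_def flip_def)
next
  case (Suc i)
  let ?k = "Suc i" and ?E = "exch (seed_at i)"
  have IH: "?E a b = flip i a * flip i b * B a b" if "a \<in> {1..2*n}" "b \<in> {1..n}" for a b
    using Suc that by simp
  show ?case
  proof (cases "a = ?k \<or> b = ?k")
    case True
    then show ?thesis using Suc.prems B_self[of ?k] IH[of a b]
      by (cases "a = b") (auto simp: mutate_def mutate_exch_def flip_def le_Suc_eq)
  next
    case False
    have "?E a ?k \<ge> 0"
      using False Suc.prems B_above[of ?k a] B_below[of a ?k] IH[of a ?k] by (auto simp: flip_def)
    moreover have "?E ?k b \<le> 0"
      using False Suc.prems B_above[of b ?k] B_below[of ?k b] IH[of ?k b] by (auto simp: flip_def)
    ultimately have "\<bar>?E a ?k\<bar> * ?E ?k b + ?E a ?k * \<bar>?E ?k b\<bar> = 0" by simp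
    then have "exch (seed_at ?k) a b = ?E a b"
      using False by (simp add: mutate_def mutate_exch_def)
    then show ?thesis using False Suc.prems IH[of a b] by (auto simp: flip_def)
  qed
qed

lemma exch_column_nonneg:
  assumes "Suc i \<le> n" "a \<in> {1..2*n}" shows "exch (seed_at i) a (Suc i) \<ge> 0"
  using exch_seed_at[of i a "Suc i"] B_above[of "Suc i" a] B_below[of a "Suc i"] assms
  by (cases "a = Suc i") (auto simp: flip_def B_self)

text \<open>By compatibility the pairing of the mutated column with a unit vector vanishes off the
  diagonal, so that mutating the form only flips signs as well.\<close>

lemma lam_seed_at:
  assumes "i \<le> n" "a \<in> {1..2*n}" "b \<in> {1..2*n}"
  shows "lam (seed_at i) a b = flip i a * flip i b * L a b"
  using assms
proof (induction i arbitrary: a b)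
  case 0
  then show ?case by (simp add: initial_seed_def flip_def)
next
  case (Suc i)
  let ?k = "Suc i" and ?E = "exch (seed_at i)" and ?L = "lam (seed_at i)"
  have IH: "?L a b = flip i a * flip i b * L a b" if "a \<in> {1..2*n}" "b \<in> {1..2*n}" for a b
    using Suc that by simp
  have pairing: "(\<Sum>t = 1..2*n. pos_part (?E t ?k) * ?L t b) = 0" if "b \<in> {1..2*n}" "b \<noteq> ?k" for b
  proof -
    have "(\<Sum>t = 1..2*n. pos_part (?E t ?k) * ?L t b) = (\<Sum>t = 1..2*n. flip i b * (B t ?k * L t b))"
    proof (rule sum.cong, simp)
      fix t assume t: "t \<in> {1..2*n}"
      have "pos_part (?E t ?k) = ?E t ?k"
        using exch_column_nonneg[of i t] Suc.prems t by (simp add: pos_part_def)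
      moreover have "?E t ?k = flip i t * B t ?k"
        using exch_seed_at[of i t ?k] Suc.prems t by (simp add: flip_def)
      ultimately show "pos_part (?E t ?k) * ?L t b = flip i b * (B t ?k * L t b)"
        using IH[of t b] t that by (simp add: flip_def)
    qed
    also have "\<dots> = 0"
      unfolding sum_distrib_left[symmetric] using column_pairing[of b ?k] that Suc.prems by simp
    finally show ?thesis .
  qed
  show ?case
    using Suc.prems IH[of a b] IH[of b a] L_swap[of a b] L_self[of ?k] pairing[of a] pairing[of b]
    by (auto simp: mutate_def mutate_lam_def flip_def)
qed

lemma var_seed_at:
  assumes "i \<le> n" "1 \<le> a"
  shows "var (seed_at i) a = (if a \<le> i then px a else x a)"
proof -
  have stable: "var (seed_at (i + p)) a = var (seed_at i) a" if "a \<le> i" for i p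
    using that by (induction p) (simp_all add: mutate_def)
  have "var (seed_at i) a = x a" if "i < a" for i
    using that by (induction i) (simp_all add: mutate_def initial_seed_def)
  then show ?thesis
    using stable[of a "n - a"] stable[of a "i - a"] assms by (auto simp: proj_var_def)
qed

text \<open>With principal coefficients, the frozen part of the column of \<open>j\<close> is \<open>e\<^sub>n\<^sub>+\<^sub>j\<close>, so the tail exponent
  is simply the part of the column strictly below row \<open>j\<close>. In the same way the term at \<open>n + j\<close> in
  sums over the rows below \<open>j\<close> merges with the mutable ones.\<close>

lemma tail_exponent_eq:
  assumes "j \<in> {1..n}" "i \<in> {1..2*n}"
  shows "tail_exponent n B j i = (if j < i then B i j else 0)"
proof -
  have "(\<Sum>v = j+1..n. B v j * unit_vec v i) = (\<Sum>v = j+1..n. if v = i then B i j else 0)"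
    by (rule sum.cong) (auto simp: unit_vec_def)
  also have "\<dots> = (if j < i \<and> i \<le> n then B i j else 0)" by auto
  finally have *: "tail_exponent n B j i = (if j < i \<and> i \<le> n then B i j else 0) + (if i = n + j then 1 else 0)"
    by (simp add: tail_exponent_def unit_vec_def)
  show ?thesis
  proof (cases "i \<le> n")
    case True
    then show ?thesis using * assms by auto
  next
    case False
    then have "i - n \<in> {1..n}" using assms by auto
    with False show ?thesis using * assms B_frozen[of "i - n" j] by auto
  qed
qed

lemma sum_column_below:
  fixes g :: "nat \<Rightarrow> int"
  assumes "j \<in> {1..n}"
  shows "(\<Sum>v = j+1..n. B v j * g v) + g (n + j) = (\<Sum>v = j+1..2*n. B v j * g v)"
proof -
  have "(\<Sum>v = j+1..2*n. B v j * g v) = (\<Sum>v = j+1..n. B v j * g v) + (\<Sum>v = n+1..2*n. B v j * g v)"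
    using sum.ub_add_nat[of "j+1" n "\<lambda>v. B v j * g v" n] assms by (simp add: mult_2)
  also have "(\<Sum>v = n+1..2*n. B v j * g v) = (\<Sum>i = 1..n. B (n + i) j * g (n + i))"
    using sum.shift_bounds_cl_nat_ivl[of "\<lambda>v. B v j * g v" 1 n n] by (simp add: mult_2 add.commute)
  also have "\<dots> = (\<Sum>i = 1..n. if i = j then g (n + j) else 0)"
    by (rule sum.cong) (use assms B_frozen in auto)
  also have "\<dots> = g (n + j)" using assms by simp
  finally show ?thesis by simp
qed

text \<open>In the exchange monomial of \<open>px j\<close> other than \<open>x\<^sub>j\<^sup>-\<^sup>1\<close>, the factors to the left of
  \<open>x\<^sub>j\<^sup>-\<^sup>1\<close> are already mutated and form \<open>head j\<close>, while those to its right are still initial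
  variables and form \<open>below j\<close>. The latter is \<open>tail j\<close> up to the normalising power of \<open>h\<close>, whose
  exponent is \<open>tail_norm j\<close>.\<close>

definition tail :: "nat \<Rightarrow> 'f" where
  "tail j = monom_of h n (seed_at (j - 1)) (tail_exponent n B j)"

definition head :: "nat \<Rightarrow> 'f" where
  "head j = prod_list (map (\<lambda>i. px i powi (- B i j)) [1..<j])"

definition below :: "nat \<Rightarrow> 'f" where
  "below j = prod_list (map (\<lambda>i. x i powi B i j) [j+1..<2*n+1])"

definition tail_norm :: "nat \<Rightarrow> int" where
  "tail_norm j = (\<Sum>k = j+1..<2*n+1. \<Sum>l = j+1..<k. B k j * B l j * L k l)"

lemma upt_split_at: "1 \<le> j \<Longrightarrow> j \<le> n \<Longrightarrow> [1..<2*n+1] = [1..<j] @ j # [j+1..<2*n+1]"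
  using upt_add_eq_append[of 1 j "2*n+1-j"] upt_conv_Cons[of j "2*n+1"] by simp

lemma tail_eq:
  assumes "j \<in> {1..n}"
  shows "tail j = h powi tail_norm j * below j"
proof -
  let ?a = "tail_exponent n B j" and ?S = "seed_at (j - 1)"
  have j: "1 \<le> j" "j \<le> n" using assms by auto
  have norm: "(\<Sum>k = 1..<2*n+1. \<Sum>l = 1..<k. ?a k * ?a l * lam ?S k l) = tail_norm j"
  proof -
    have zero: "?a i = 0" if "i \<in> {1..2*n}" "i \<le> j" for i
      using tail_exponent_eq[OF assms that(1)] that by simp
    have inner: "(\<Sum>l = 1..<k. ?a k * ?a l * lam ?S k l) = (\<Sum>l = j+1..<k. B k j * B l j * L k l)"
      if "k \<in> {j+1..<2*n+1}" for k
    proof -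
      have "(\<Sum>l = 1..<k. ?a k * ?a l * lam ?S k l) = (\<Sum>l = j+1..<k. ?a k * ?a l * lam ?S k l)"
        using j that zero by (subst sum_split_at[of j]) auto
      also have "\<dots> = (\<Sum>l = j+1..<k. B k j * B l j * L k l)"
        using j that by (intro sum.cong) (auto simp: tail_exponent_eq[OF assms] lam_seed_at flip_def)
      finally show ?thesis .
    qed
    have "(\<Sum>k = 1..<2*n+1. \<Sum>l = 1..<k. ?a k * ?a l * lam ?S k l)
        = (\<Sum>k = j+1..<2*n+1. \<Sum>l = 1..<k. ?a k * ?a l * lam ?S k l)"
      using j zero by (subst sum_split_at[of j]) auto
    then show ?thesis using inner by (simp add: tail_norm_def)
  qed
  have "map (\<lambda>i. var ?S i powi ?a i) [1..<j] = map (\<lambda>i. 1) [1..<j]"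
    using j by (intro map_cong) (auto simp: tail_exponent_eq[OF assms])
  moreover have "map (\<lambda>i. var ?S i powi ?a i) [j+1..<2*n+1] = map (\<lambda>i. x i powi B i j) [j+1..<2*n+1]"
    using j by (intro map_cong) (auto simp: tail_exponent_eq[OF assms] var_seed_at)
  ultimately have "prod_list (map (\<lambda>i. var ?S i powi ?a i) [1..<2*n+1]) = below j"
    using j unfolding upt_split_at[OF j] below_def map_append list.map
    by (simp add: tail_exponent_eq[OF assms] map_replicate_const prod_list_replicate
        del: upt_Suc map_eq_conv)
  with norm show ?thesis
    unfolding tail_def monom_of_def by (simp add: atLeastLessThanSuc_atLeastAtMost del: upt_Suc)
qed

lemma two_M_eq:
  assumes "j \<in> {1..n}"
  shows "two_M n L B j = (\<Sum>k = 1..<j. \<Sum>l = 1..<k. B k j * B l j * L k l)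
     + (\<Sum>r = 1..<j. B r j * L r j) + (\<Sum>r = j+1..<2*n+1. B r j * L j r)"
proof -
  have iv: "{a..j-1} = {a..<j}" for a using assms by auto
  have "- (\<Sum>r = 1..<j. \<Sum>t = r+1..<j. B r j * B t j * L r t)
      = (\<Sum>k = 1..<j. \<Sum>l = 1..<k. B k j * B l j * L k l)"
    unfolding sum_triangle_swap sum_negf[symmetric]
  proof (intro sum.cong refl)
    fix k l assume "k \<in> {1..<j}" "l \<in> {1..<k}"
    then show "- (B l j * B k j * L l k) = B k j * B l j * L k l"
      using L_swap[of l k] assms by auto
  qed
  then show ?thesis
    using sum_column_below[OF assms, of "\<lambda>r. L j r"] unfolding two_M_def iv
    by (simp add: atLeastLessThanSuc_atLeastAtMost)
qed

text \<open>The normalising exponent of the exchange monomial is a sum over pairs of indices. The pairs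
  with one index above and one below row \<open>j\<close> would contribute
  \<open>\<Sum>\<^sub>l\<^sub><\<^sub>j b\<^sub>l\<^sub>j \<Lambda>(\<Sum>\<^sub>k\<^sub>>\<^sub>j b\<^sub>k\<^sub>j e\<^sub>k, e\<^sub>l)\<close>. By compatibility the pairing in it is minus that of
  the entries above row \<open>j\<close> with \<open>e\<^sub>l\<close>, so the contribution is the value of a skew form at a pair of
  equal vectors. This is why \<open>two_M\<close> has no mixed terms.\<close>

lemma mixed_pairs_cancel:
  assumes "j \<in> {1..n}"
  shows "(\<Sum>k = j+1..<2*n+1. \<Sum>l = 1..<j. B k j * B l j * L k l) = 0"
proof -
  have "(\<Sum>k = j+1..<2*n+1. \<Sum>l = 1..<j. B k j * B l j * L k l)
      = (\<Sum>l = 1..<j. B l j * (\<Sum>k = j+1..<2*n+1. B k j * L k l))"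
    by (subst sum.swap) (simp add: sum_distrib_left mult.left_commute mult.assoc del: sum.op_ivl_Suc)
  also have "\<dots> = (\<Sum>l = 1..<j. \<Sum>k = 1..<j. B l j * B k j * L l k)"
  proof (rule sum.cong, simp)
    fix l assume l: "l \<in> {1..<j}"
    have "(\<Sum>k = 1..<2*n+1. B k j * L k l) = 0"
      using column_pairing[of l j] l assms by (simp add: atLeastLessThanSuc_atLeastAtMost)
    then have "(\<Sum>k = j+1..<2*n+1. B k j * L k l) = - (\<Sum>k = 1..<j. B k j * L k l)"
      using sum_split_at[of j "2*n+1" "\<lambda>k. B k j * L k l"] B_self[OF assms] assms by simp
    also have "\<dots> = (\<Sum>k = 1..<j. B k j * L l k)"
      unfolding sum_negf[symmetric]
    proof (rule sum.cong, simp)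
      fix k assume "k \<in> {1..<j}"
      then show "- (B k j * L k l) = B k j * L l k" using L_swap[of k l] l assms by auto
    qed
    finally show "B l j * (\<Sum>k = j+1..<2*n+1. B k j * L k l) = (\<Sum>k = 1..<j. B l j * B k j * L l k)"
      by (simp add: sum_distrib_left mult.assoc)
  qed
  also have "\<dots> = 0"
    using assms by (intro sum_skew_form_zero L_swap) auto
  finally show ?thesis .
qed

text \<open>The column of \<open>j\<close> is nonnegative in the seed before the mutation at \<open>j\<close>, so that one of the two
  exchange monomials is just \<open>x\<^sub>j\<^sup>-\<^sup>1\<close>. The pairs of indices in the normalising exponent of the
  other one fall into those inside \<open>tail j\<close>, the mixed ones, which cancel, and those counted by
  \<open>two_M\<close>.\<close>

lemma exchange_relation:
  assumes "j \<in> {1..n}"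
  shows "px j = h powi two_M n L B j * head j * inverse (x j) * tail j + inverse (x j)"
proof -
  let ?S = "seed_at (j - 1)"
  have j: "1 \<le> j" "j \<le> n" using assms by auto
  have x_j: "var ?S j = x j" using var_seed_at[of "j-1" j] j by (cases j) auto
  have exch_col: "exch ?S i j = (if i < j then - B i j else B i j)" if "i \<in> {1..2*n}" for i
    using exch_seed_at[of "j-1" i j] that j by (auto simp: flip_def)
  have nonneg: "exch ?S i j \<ge> 0" if "i \<in> {1..2*n}" for i
    using exch_column_nonneg[of "j-1" i] j that by simp
  \<comment> \<open>the exponents of the two exchange monomials\<close>
  define a where "a i = - unit_vec j i + pos_part (exch ?S i j)" for i
  define c where "c i = - unit_vec j i + pos_part (- exch ?S i j)" for i
  have a: "a i = (if i < j then - B i j else if i = j then - 1 else B i j)" if "i \<in> {1..2*n}" for i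
    using nonneg[OF that] exch_col[OF that] B_self[OF assms] that by (auto simp: a_def unit_vec_def pos_part_def)
  have c: "c i = (if i = j then - 1 else 0)" if "i \<in> {1..2*n}" for i
    using nonneg[OF that] by (auto simp: c_def unit_vec_def pos_part_def)

  have "monom_of h n ?S c = inverse (x j)"
  proof -
    have "(\<Sum>k = 1..2*n. \<Sum>l = 1..<k. c k * c l * lam ?S k l) = 0"
      by (intro sum.neutral ballI) (auto simp: c)
    moreover have "map (\<lambda>i. var ?S i powi c i) [1..<j] = map (\<lambda>i. 1) [1..<j]"
      using j by (intro map_cong) (auto simp: c)
    moreover have "map (\<lambda>i. var ?S i powi c i) [j+1..<2*n+1] = map (\<lambda>i. 1) [j+1..<2*n+1]"
      using j by (intro map_cong) (auto simp: c)
    moreover have "var ?S j powi c j = inverse (x j)"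
      using j x_j by (simp add: c power_int_minus)
    ultimately show ?thesis
      unfolding monom_of_def upt_split_at[OF j]
      by (simp add: map_replicate_const prod_list_replicate del: upt_Suc)
  qed
  moreover have "monom_of h n ?S a = h powi two_M n L B j * head j * inverse (x j) * tail j"
  proof -
    let ?G = "\<lambda>k l. a k * a l * lam ?S k l"
    have above: "(\<Sum>k = 1..<j. \<Sum>l = 1..<k. ?G k l) = (\<Sum>k = 1..<j. \<Sum>l = 1..<k. B k j * B l j * L k l)"
      using j by (intro sum.cong) (auto simp: a lam_seed_at flip_def)
    have at_j: "(\<Sum>l = 1..<j. ?G j l) = (\<Sum>r = 1..<j. B r j * L r j)"
    proof (rule sum.cong, simp)
      fix l assume "l \<in> {1..<j}"
      then show "?G j l = B l j * L l j"
        using j L_swap[of j l] by (auto simp: a lam_seed_at flip_def)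
    qed
    have under: "(\<Sum>l = 1..<k. ?G k l) = (\<Sum>l = 1..<j. B k j * B l j * L k l)
        + (B k j * L j k + (\<Sum>l = j+1..<k. B k j * B l j * L k l))" if k: "k \<in> {j+1..<2*n+1}" for k
    proof -
      have "(\<Sum>l = 1..<j. ?G k l) = (\<Sum>l = 1..<j. B k j * B l j * L k l)"
        using j k by (intro sum.cong) (auto simp: a lam_seed_at flip_def)
      moreover have "?G k j = B k j * L j k"
        using j k L_swap[of k j] by (auto simp: a lam_seed_at flip_def)
      moreover have "(\<Sum>l = j+1..<k. ?G k l) = (\<Sum>l = j+1..<k. B k j * B l j * L k l)"
        using j k by (intro sum.cong) (auto simp: a lam_seed_at flip_def)
      ultimately show ?thesis
        using sum_split_at[of j k "\<lambda>l. ?G k l"] j k by simp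
    qed
    have "(\<Sum>k = j+1..<2*n+1. \<Sum>l = 1..<k. ?G k l)
        = (\<Sum>k = j+1..<2*n+1. (\<Sum>l = 1..<j. B k j * B l j * L k l)
            + (B k j * L j k + (\<Sum>l = j+1..<k. B k j * B l j * L k l)))"
      by (rule sum.cong[OF refl under])
    then have under_sum: "(\<Sum>k = j+1..<2*n+1. \<Sum>l = 1..<k. ?G k l)
        = (\<Sum>k = j+1..<2*n+1. B k j * L j k) + (\<Sum>k = j+1..<2*n+1. \<Sum>l = j+1..<k. B k j * B l j * L k l)"
      by (simp only: sum.distrib mixed_pairs_cancel[OF assms] add_0)
    have "(\<Sum>k = 1..<2*n+1. \<Sum>l = 1..<k. ?G k l) = (\<Sum>k = 1..<j. \<Sum>l = 1..<k. ?G k l)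
        + ((\<Sum>l = 1..<j. ?G j l) + (\<Sum>k = j+1..<2*n+1. \<Sum>l = 1..<k. ?G k l))"
      using j by (intro sum_split_at) auto
    also have "\<dots> = two_M n L B j + tail_norm j"
      unfolding above at_j under_sum two_M_eq[OF assms] tail_norm_def
      by (simp del: sum.op_ivl_Suc)
    finally have norm: "(\<Sum>k = 1..2*n. \<Sum>l = 1..<k. ?G k l) = two_M n L B j + tail_norm j"
      by (simp add: atLeastLessThanSuc_atLeastAtMost)
    have "map (\<lambda>i. var ?S i powi a i) [1..<j] = map (\<lambda>i. px i powi (- B i j)) [1..<j]"
      using j by (intro map_cong) (auto simp: a var_seed_at)
    moreover have "map (\<lambda>i. var ?S i powi a i) [j+1..<2*n+1] = map (\<lambda>i. x i powi B i j) [j+1..<2*n+1]"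
      using j by (intro map_cong) (auto simp: a var_seed_at)
    moreover have "var ?S j powi a j = inverse (x j)"
      using j x_j by (simp add: a power_int_minus)
    ultimately have "prod_list (map (\<lambda>i. var ?S i powi a i) [1..<2*n+1]) = head j * (inverse (x j) * below j)"
      unfolding upt_split_at[OF j] by (simp add: head_def below_def del: upt_Suc map_eq_conv)
    then have "monom_of h n ?S a = h powi two_M n L B j * (h powi tail_norm j * (head j * (inverse (x j) * below j)))"
      unfolding monom_of_def norm by (simp add: powi_h_mult_assoc)
    also have "h powi tail_norm j * (head j * (inverse (x j) * below j)) = head j * (inverse (x j) * tail j)"
      by (simp only: tail_eq[OF assms] powi_h_left_commute)
    finally show ?thesis by (simp add: mult.assoc)
  qed
  moreover have "px j = monom_of h n ?S a + monom_of h n ?S c"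
  proof -
    have "seed_at j = mutate h n j ?S" using j by (cases j) auto
    then have "px j = mutate_var h n j ?S" using var_seed_at[of j j] j by (simp add: mutate_def)
    then show ?thesis by (simp add: mutate_var_def a_def[abs_def] c_def[abs_def])
  qed
  ultimately show ?thesis by simp
qed

section \<open>The commutation formula\<close>

lemma initial_seed_sel:
  "var (initial_seed X L B) = x" "lam (initial_seed X L B) = L" "exch (initial_seed X L B) = B"
  by (simp_all add: initial_seed_def)

lemma x_x_comm:
  "a \<in> {1..2*n} \<Longrightarrow> b \<in> {1..2*n} \<Longrightarrow> twisted_comm (2 * L a b) (x a) (x b) = 0"
  by (simp add: twisted_comm_def x_mult)

lemma inverse_x_x_comm:
  "a \<in> {1..2*n} \<Longrightarrow> b \<in> {1..2*n} \<Longrightarrow> twisted_comm (- 2 * L a b) (inverse (x a)) (x b) = 0"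
  using twisted_comm_inverse_zero[OF x_x_comm x_nonzero, of a b] by simp

lemma tail_x_comm:
  assumes "j \<in> {1..n}" "k \<in> {1..2*n}"
  shows "twisted_comm (2 * (\<Sum>r = j+1..2*n. B r j * L r k)) (tail j) (x k) = 0"
proof -
  have "twisted_comm (\<Sum>r = j+1..<2*n+1. B r j * (2 * L r k)) (below j) (x k) = 0"
    unfolding below_def using assms
    by (intro twisted_comm_prod_list_zero twisted_comm_powi_zero x_x_comm) (auto simp: x_nonzero)
  then show ?thesis
    unfolding tail_eq[OF assms(1)] twisted_comm_scale sum_distrib_left
    by (simp add: atLeastLessThanSuc_atLeastAtMost mult.left_commute)
qed

text \<open>The twist of \<open>x\<^sub>k\<close> past the other exchange monomial of \<open>px j\<close> is its twist past
  \<open>x\<^sub>j\<^sup>-\<^sup>1\<close>, corrected by the pairing of the \<open>j\<close>-th column of \<open>B\<close> with \<open>e\<^sub>k\<close>. As everything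
  to the right of \<open>head j\<close> consists of initial variables, only \<open>head j\<close> contributes to the
  commutator.\<close>

lemma exchange_monomial_comm:
  assumes "j \<in> {1..n}" "k \<in> {1..2*n}"
  shows "twisted_comm (2 * (\<Sum>t = 1..2*n. B t j * L t k) - 2 * L j k)
           (h powi two_M n L B j * head j * inverse (x j) * tail j) (x k)
       = h powi (two_M n L B j + (2 * (\<Sum>r = j+1..2*n. B r j * L r k) - 2 * L j k)) *
           twisted_comm (\<Sum>r = 1..<j. - B r j * (- 2 * L r k)) (head j) (x k) * inverse (x j) * tail j"
proof -
  let ?e = "2 * (\<Sum>r = j+1..2*n. B r j * L r k)" and ?e' = "\<Sum>r = 1..<j. - B r j * (- 2 * L r k)"
  have "twisted_comm (- 2 * L j k + ?e) (inverse (x j) * tail j) (x k) = 0"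
    using assms by (intro twisted_comm_mult_zero inverse_x_x_comm tail_x_comm) auto
  then have head: "twisted_comm (?e' + (- 2 * L j k + ?e)) (head j * (inverse (x j) * tail j)) (x k)
      = h powi (- 2 * L j k + ?e) * twisted_comm ?e' (head j) (x k) * (inverse (x j) * tail j)"
    by (simp add: twisted_comm_mult)
  have "(\<Sum>t = 1..2*n. B t j * L t k) = (\<Sum>r = 1..<j. B r j * L r k) + (\<Sum>r = j+1..2*n. B r j * L r k)"
    using sum_split_at[of j "2*n+1" "\<lambda>t. B t j * L t k"] assms B_self[OF assms(1)]
    by (simp add: atLeastLessThanSuc_atLeastAtMost)
  then have "2 * (\<Sum>t = 1..2*n. B t j * L t k) - 2 * L j k = ?e' + (- 2 * L j k + ?e)"
    by (simp add: sum_distrib_left algebra_simps)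
  with head show ?thesis
    by (simp only: mult.assoc twisted_comm_scale powi_h_mult_assoc) (simp add: algebra_simps)
qed

text \<open>For \<open>k \<noteq> j\<close> the column of \<open>j\<close> pairs to zero with \<open>e\<^sub>k\<close>, so both exchange monomials carry the
  same twist and the commutator of \<open>x\<^sub>j\<^sup>-\<^sup>1\<close> drops out.\<close>

lemma px_comm_off_diagonal:
  assumes "j \<in> {1..n}" "k \<in> {1..2*n}" "k \<noteq> j"
  shows "twisted_comm (- 2 * L j k) (px j) (x k)
       = h powi (two_M n L B j + (2 * (\<Sum>r = j+1..2*n. B r j * L r k) - 2 * L j k)) *
           twisted_comm (\<Sum>r = 1..<j. - B r j * (- 2 * L r k)) (head j) (x k) * inverse (x j) * tail j"
proof -
  have "(\<Sum>t = 1..2*n. B t j * L t k) = 0" using column_pairing[of k j] assms by simp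
  moreover have "twisted_comm (- 2 * L j k) (inverse (x j)) (x k) = 0"
    using assms by (intro inverse_x_x_comm) auto
  ultimately show ?thesis
    using exchange_monomial_comm[OF assms(1,2)]
    by (subst exchange_relation[OF assms(1)]) (simp add: twisted_comm_add)
qed

text \<open>Only the projective variables \<open>px r\<close> with \<open>r < j\<close> enter \<open>head j\<close>, and inductively they commute
  with \<open>x\<^sub>k\<close> up to powers of \<open>h\<close>.\<close>

lemma px_x_comm:
  assumes "j \<in> {1..n}" "k \<in> {1..2*n}" "j < k"
  shows "twisted_comm (- 2 * L j k) (px j) (x k) = 0"
  using assms
proof (induction j rule: less_induct)
  case (less j)
  have "twisted_comm (\<Sum>r = 1..<j. - B r j * (- 2 * L r k)) (head j) (x k) = 0"
    unfolding head_def
  proof (intro twisted_comm_prod_list_zero twisted_comm_powi_zero)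
    fix r assume "r \<in> {1..<j}"
    then show "twisted_comm (- 2 * L r k) (px r) (x k) = 0" "px r \<noteq> 0 \<or> - B r j \<ge> 0"
      using less B_above[of j r] by auto
  qed (use less in auto)
  then show ?case using px_comm_off_diagonal[of j k] less by simp
qed

text \<open>The elements \<open>f_pow\<close> are the Leibniz expansions of the commutator of a power.\<close>

lemma f_pow_eq_comm:
  assumes "f_one h n (initial_seed X L B) k t = twisted_comm (- 2 * L t k) (px t) (x k)" "b \<le> 0"
  shows "f_pow h n (initial_seed X L B) k t (nat (- b)) = twisted_comm (- b * (- 2 * L t k)) (px t powi (- b)) (x k)"
proof -
  have "twisted_comm (int (nat (- b)) * (- 2 * L t k)) (px t ^ nat (- b)) (x k)
      = f_pow h n (initial_seed X L B) k t (nat (- b))"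
    unfolding twisted_comm_power f_pow.simps assms(1)
    by (intro sum.cong) (simp_all add: initial_seed_sel algebra_simps)
  then show ?thesis using assms(2) by (simp add: power_int_def)
qed

text \<open>Only the factors of \<open>head j\<close> of index at least \<open>k\<close> can fail to commute with \<open>x\<^sub>k\<close> up to a
  power of \<open>h\<close>, which gives the range of summation in \<open>M_one\<close>.\<close>

theorem f_one_eq_comm:
  assumes "j \<in> {1..n}" "1 \<le> k" "k \<le> j"
  shows "f_one h n (initial_seed X L B) k j = twisted_comm (- 2 * L j k) (px j) (x k)"
  using assms
proof (induction j rule: less_induct)
  case (less j)
  let ?S = "initial_seed X L B"
  show ?case
  proof (cases "k = j")
    case True
    then show ?thesis
      using less L_self[of j] by (simp add: f_one.simps twisted_comm_def initial_seed_sel)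
  next
    case False
    then have k: "k \<in> {1..2*n}" "k < j" using less by auto
    let ?P = "\<lambda>a b. prod_list (map (\<lambda>i. px i powi (- B i j)) [a..<b])"
    let ?c = "two_M n L B j + (2 * (\<Sum>r = j+1..2*n. B r j * L r k) - 2 * L j k)"
    let ?s = "\<lambda>t. 2 * (\<Sum>r = t+1..<j. B r j * L r k)"
    let ?comm = "\<lambda>t. twisted_comm (- B t j * (- 2 * L t k)) (px t powi (- B t j)) (x k)"
    let ?term = "\<lambda>t. h powi (\<Sum>r = t+1..<j. - B r j * (- 2 * L r k)) * ?P 1 t * ?comm t * ?P (t+1) j"
    \<comment> \<open>the Leibniz rule sums over all factors of \<open>head j\<close>; those before \<open>k\<close> drop out\<close>
    have "?comm t = 0" if "t \<in> {1..<k}" for t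
      using that less k B_above[of j t] by (intro twisted_comm_powi_zero px_x_comm) auto
    then have low: "(\<Sum>t = 1..<k. ?term t) = 0" by (intro sum.neutral) auto
    have high: "?term t = h powi ?s t * ?P 1 t * f_pow h n ?S k t (nat (- B t j)) * ?P (t+1) j"
      if "t \<in> {k..<j}" for t
    proof -
      have "f_pow h n ?S k t (nat (- B t j)) = ?comm t"
        using that less k B_above[of j t] by (intro f_pow_eq_comm less.IH) auto
      moreover have "(\<Sum>r = t+1..<j. - B r j * (- 2 * L r k)) = ?s t"
        by (simp add: sum_distrib_left mult.left_commute)
      ultimately show ?thesis by simp
    qed
    have "twisted_comm (\<Sum>r = 1..<j. - B r j * (- 2 * L r k)) (head j) (x k) = (\<Sum>t = 1..<j. ?term t)"
      unfolding head_def using less by (intro twisted_comm_prod_list) auto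
    also have "\<dots> = (\<Sum>t = k..<j. ?term t)"
      using sum.atLeastLessThan_concat[of 1 k j ?term] less.prems k unfolding low by simp
    also have "\<dots> = (\<Sum>t = k..<j. h powi ?s t * ?P 1 t * f_pow h n ?S k t (nat (- B t j)) * ?P (t+1) j)"
      by (rule sum.cong[OF refl high])
    finally have head: "h powi ?c * twisted_comm (\<Sum>r = 1..<j. - B r j * (- 2 * L r k)) (head j) (x k) * inverse (x j)
        = (\<Sum>t = k..<j. h powi (?c + ?s t) * ?P 1 t * f_pow h n ?S k t (nat (- B t j)) * ?P (t+1) j * inverse (x j))"
      by (simp add: sum_distrib_left sum_distrib_right powi_h_add mult.assoc)
    also have "\<dots> = M_one h n ?S k j"
    proof -
      have exponent: "?c + ?s t = two_M n L B j + 2 * (- L j k + L (n + j) k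
              + (\<Sum>v = j+1..n. B v j * L v k) + (\<Sum>r = t+1..j-1. B r j * L r k))" for t
      proof -
        have "{t+1..j-1} = {t+1..<j}" using k by auto
        then show ?thesis
          using sum_column_below[of j "\<lambda>v. L v k"] less by (simp add: algebra_simps)
      qed
      show ?thesis unfolding M_one.simps initial_seed_sel by (simp only: exponent)
    qed
    finally have "twisted_comm (- 2 * L j k) (px j) (x k) = M_one h n ?S k j * tail j"
      using px_comm_off_diagonal[of j k] less k by simp
    then show ?thesis
      using k by (simp add: f_one.simps tail_def initial_seed_sel)
  qed
qed


section \<open>Membership in the generated subring\<close>

definition coeff_gens :: "nat \<Rightarrow> nat \<Rightarrow> 'f set" where
  "coeff_gens k m = ZP h n (initial_seed X L B) \<union> px ` {1..m} \<union> x ` {k+1..n}"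

abbreviation coeff_ring :: "nat \<Rightarrow> nat \<Rightarrow> 'f set" where
  "coeff_ring k m \<equiv> gen_subring (coeff_gens k m)"

lemma coeff_ring_mono: "m \<le> m' \<Longrightarrow> coeff_ring k m \<subseteq> coeff_ring k m'"
  unfolding coeff_gens_def by (intro gen_subring_mono) auto

lemma powi_h_in_coeff_ring: "h powi e \<in> coeff_ring k m"
  unfolding coeff_gens_def
  by (intro gen_subring_powi disjI2) (auto intro!: gen_subring_base simp: ZP_def)

lemma px_in_coeff_ring: "1 \<le> i \<Longrightarrow> i \<le> m \<Longrightarrow> px i \<in> coeff_ring k m"
  unfolding coeff_gens_def by (intro gen_subring_base) auto

lemma x_in_coeff_ring:
  assumes "k < i" "i \<le> 2*n" shows "x i \<in> coeff_ring k m"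
proof (cases "i \<le> n")
  case True
  then show ?thesis
    using assms unfolding coeff_gens_def by (intro gen_subring_base) auto
next
  case False
  then have "x i \<in> ZP h n (initial_seed X L B)"
    unfolding ZP_def using assms by (intro gen_subring_base) (auto simp: initial_seed_sel)
  then show ?thesis
    unfolding coeff_gens_def by (intro gen_subring_base) auto
qed

lemma head_factors_in_coeff_ring:
  assumes "j \<in> {1..n}" "1 \<le> a" "b \<le> j" "b \<le> m + 1"
  shows "prod_list (map (\<lambda>i. px i powi (- B i j)) [a..<b]) \<in> coeff_ring k m"
proof (intro gen_subring_closed gen_subring_powi disjI1 px_in_coeff_ring)
  fix i assume "i \<in> set [a..<b]"
  then show "1 \<le> i" "i \<le> m" "0 \<le> - B i j" using assms B_above[of j i] by auto
qed

text \<open>At the start of the recursion the variable \<open>x\<^sub>k\<close> cancels against the \<open>x\<^sub>k\<^sup>-\<^sup>1\<close> in the exchange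
  monomials of \<open>px k\<close>: the summand \<open>x\<^sub>k\<^sup>-\<^sup>1\<close> commutes with \<open>x\<^sub>k\<close>, and the other one commutes with
  it up to a power of \<open>h\<close>.\<close>

lemma diagonal_commutator_factors:
  assumes "k \<in> {1..n}"
  shows "\<exists>N \<in> coeff_ring k (k - 1). px k * x k - x k * px k = N * tail k"
proof -
  let ?Z = "h powi two_M n L B k * head k * inverse (x k) * tail k"
  let ?e = "2 * (\<Sum>t = 1..2*n. B t k * L t k) - 2 * L k k"
  have x0: "x k \<noteq> 0" using assms x_nonzero by simp
  have head: "twisted_comm e (head k) (x k) = 0" if "e = (\<Sum>r = 1..<k. - B r k * (- 2 * L r k))" for e
    unfolding head_def that
  proof (intro twisted_comm_prod_list_zero twisted_comm_powi_zero px_x_comm)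
    fix r assume "r \<in> {1..<k}"
    then show "px r \<noteq> 0 \<or> - B r k \<ge> 0" using assms B_above[of k r] by auto
  qed (use assms in auto)
  define e' where "e' = (\<Sum>r = 1..<k. - B r k * (- 2 * L r k))"
  have "twisted_comm ?e ?Z (x k) = 0"
    using exchange_monomial_comm[of k k] head[OF refl] assms by simp
  then have "?Z * x k = h powi ?e * (x k * ?Z)"
    using twisted_comm_zeroD[of ?e ?Z "x k"] by (simp only: mult.assoc)
  moreover have "x k * ?Z = h powi (two_M n L B k - e') * head k * tail k"
  proof -
    have "head k * x k = h powi e' * x k * head k"
      by (intro twisted_comm_zeroD head) (simp add: e'_def)
    then have swap: "x k * head k = h powi (- e') * (head k * x k)"
      by (simp add: mult.assoc powi_h_mult_assoc)
    have "x k * (head k * (inverse (x k) * tail k)) = (x k * head k) * (inverse (x k) * tail k)"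
      by (simp only: mult.assoc)
    also have "\<dots> = h powi (- e') * (head k * (x k * (inverse (x k) * tail k)))"
      unfolding swap by (simp only: mult.assoc)
    also have "x k * (inverse (x k) * tail k) = tail k"
      using x0 by (simp add: mult.assoc[symmetric])
    finally have "h powi two_M n L B k * (x k * (head k * (inverse (x k) * tail k)))
        = h powi two_M n L B k * (h powi (- e') * (head k * tail k))" by simp
    moreover have "x k * ?Z = h powi two_M n L B k * (x k * (head k * (inverse (x k) * tail k)))"
      by (simp only: mult.assoc powi_h_left_commute)
    ultimately show ?thesis
      by (simp only: powi_h_mult_assoc mult.assoc diff_conv_add_uminus)
  qed
  moreover have "px k = ?Z + inverse (x k)" by (rule exchange_relation[OF assms])
  ultimately have "px k * x k - x k * px k
      = ((h powi ?e - 1) * h powi (two_M n L B k - e') * head k) * tail k"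
    using x0 by (simp add: algebra_simps)
  moreover have "(h powi ?e - 1) * h powi (two_M n L B k - e') * head k \<in> coeff_ring k (k - 1)"
    unfolding head_def using assms powi_h_in_coeff_ring[of 0]
    by (intro gen_subring_closed powi_h_in_coeff_ring head_factors_in_coeff_ring) auto
  ultimately show ?thesis by blast
qed

text \<open>The summands of \<open>M_one\<close> end in \<open>x\<^sub>j\<^sup>-\<^sup>1\<close>, which is not among the generators of the ring.
  The elements that absorb it form a left module, and are also stable under right multiplication by
  ring elements that commute with \<open>x\<^sub>j\<close> up to a power of \<open>h\<close>.\<close>

definition absorbs_inverse :: "nat \<Rightarrow> nat \<Rightarrow> nat \<Rightarrow> 'f set" where
  "absorbs_inverse k m j = {z. z * inverse (x j) \<in> coeff_ring k m}"

lemma absorbs_inverse_mult_left: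
  "r \<in> coeff_ring k m \<Longrightarrow> z \<in> absorbs_inverse k m j \<Longrightarrow> r * z \<in> absorbs_inverse k m j"
  by (simp add: absorbs_inverse_def mult.assoc gen_subring_closed)

lemma absorbs_inverse_mult_right:
  assumes z: "z \<in> absorbs_inverse k m j" and r: "r \<in> coeff_ring k m"
    and comm: "twisted_comm e r (x j) = 0" and j: "j \<in> {1..2*n}"
  shows "z * r \<in> absorbs_inverse k m j"
proof -
  have x0: "x j \<noteq> 0" using j by (rule x_nonzero)
  have "inverse (x j) * (r * x j) * inverse (x j) = inverse (x j) * (h powi e * (x j * r)) * inverse (x j)"
    using twisted_comm_zeroD[OF comm] by (simp add: mult.assoc)
  also have "\<dots> = h powi e * (inverse (x j) * x j * r * inverse (x j))"
    by (simp only: mult.assoc powi_h_left_commute)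
  finally have "inverse (x j) * r = h powi e * (r * inverse (x j))"
    using x0 by (simp add: mult.assoc)
  then have "r * inverse (x j) = h powi (- e) * (inverse (x j) * r)"
    by (simp add: powi_h_mult_assoc)
  then have "z * r * inverse (x j) = h powi (- e) * ((z * inverse (x j)) * r)"
    by (simp only: mult.assoc powi_h_left_commute)
  also have "\<dots> \<in> coeff_ring k m"
    using z[unfolded absorbs_inverse_def mem_Collect_eq] r
    by (intro gen_subring_mult[OF powi_h_in_coeff_ring gen_subring_mult])
  finally show ?thesis by (simp add: absorbs_inverse_def)
qed

lemma absorbs_inverse_sum:
  "(\<And>i. i \<in> I \<Longrightarrow> f i \<in> absorbs_inverse k m j) \<Longrightarrow> sum f I \<in> absorbs_inverse k m j"
  by (auto simp: absorbs_inverse_def sum_distrib_right intro: gen_subring_closed)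

lemma tail_absorbs_inverse:
  assumes t: "t \<in> {1..n}" "k \<le> t" "t < j" and j: "j \<in> {1..n}" and neg: "B t j < 0"
  shows "tail t \<in> absorbs_inverse k m j"
proof -
  have x0: "x j \<noteq> 0" using j x_nonzero by simp
  have "B j t > 0" using B_above_neg_iff[OF t(1) j] neg by simp
  have list: "[t+1..<2*n+1] = [t+1..<j] @ j # [j+1..<2*n+1]"
    using upt_add_eq_append[of "t+1" j "2*n+1-j"] upt_conv_Cons[of j "2*n+1"] t j by (simp del: upt_Suc)
  let ?P = "\<lambda>a b. prod_list (map (\<lambda>i. x i powi B i t) [a..<b])"
  have mem: "?P a b \<in> coeff_ring k m" if "t < a" "b \<le> 2*n+1" for a b
    using that t by (intro gen_subring_closed gen_subring_powi disjI1 x_in_coeff_ring B_below) auto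
  have "x j powi B j t * inverse (x j) = x j powi (B j t - 1)"
    using x0 power_int_add[of "x j" "B j t" "- 1"] by (simp add: power_int_minus)
  then have "x j powi B j t \<in> absorbs_inverse k m j"
    unfolding absorbs_inverse_def using t j \<open>B j t > 0\<close>
    by (auto intro!: gen_subring_powi disjI1 x_in_coeff_ring)
  moreover have "twisted_comm (\<Sum>i = j+1..<2*n+1. B i t * (2 * L i j)) (?P (j+1) (2*n+1)) (x j) = 0"
    using t j by (intro twisted_comm_prod_list_zero twisted_comm_powi_zero x_x_comm) (auto simp: x_nonzero)
  ultimately have "?P (t+1) j * (x j powi B j t * ?P (j+1) (2*n+1)) \<in> absorbs_inverse k m j"
    using t j by (intro absorbs_inverse_mult_left absorbs_inverse_mult_right mem) auto
  then have "below t \<in> absorbs_inverse k m j"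
    unfolding below_def list by (simp del: upt_Suc)
  then show ?thesis
    unfolding tail_eq[OF t(1)] by (intro absorbs_inverse_mult_left powi_h_in_coeff_ring)
qed

text \<open>The summand of index \<open>t\<close> vanishes unless \<open>b\<^sub>t\<^sub>j < 0\<close>. In that case \<open>b\<^sub>j\<^sub>t > 0\<close>, so that the
  tail of index \<open>t\<close>, which occurs in each term of \<open>f_pow\<close>, contains a factor \<open>x\<^sub>j\<close>. It cancels the
  trailing \<open>x\<^sub>j\<^sup>-\<^sup>1\<close>, since the projective variables in between commute with \<open>x\<^sub>j\<close> up to powers
  of \<open>h\<close>.\<close>

theorem M_one_in_coeff_ring:
  assumes "j \<in> {1..n}" "1 \<le> k" "k < j"
  shows "M_one h n (initial_seed X L B) k j \<in> coeff_ring k (j - 1)"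
  using assms
proof (induction j rule: less_induct)
  case (less j)
  let ?S = "initial_seed X L B"
  have factors: "\<exists>N \<in> coeff_ring k (t - 1). f_one h n ?S k t = N * tail t" if "t \<in> {k..<j}" for t
  proof (cases "t = k")
    case True
    then show ?thesis
      using diagonal_commutator_factors[of k] less by (simp add: f_one.simps initial_seed_sel)
  next
    case False
    then show ?thesis
      using less.IH[of t] that less.prems by (auto simp: f_one.simps tail_def initial_seed_sel)
  qed
  have px_comm: "twisted_comm (- 2 * L i j) (px i) (x j) = 0" if "1 \<le> i" "i < j" for i
    using that less.prems by (intro px_x_comm) auto
  have "f_pow h n ?S k t (nat (- B t j)) * prod_list (map (\<lambda>i. px i powi (- B i j)) [t+1..<j])
      \<in> absorbs_inverse k (j - 1) j" if t: "t \<in> {k..<j}" for t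
  proof (cases "B t j < 0")
    case False
    then show ?thesis
      by (simp add: f_pow.simps absorbs_inverse_def gen_subring_zero coeff_gens_def)
  next
    case True
    obtain N where N: "N \<in> coeff_ring k (t - 1)" "f_one h n ?S k t = N * tail t"
      using factors[OF t] by blast
    have "t - 1 \<le> j - 1" using t by (intro diff_le_mono) simp
    then have "N \<in> coeff_ring k (j - 1)" using coeff_ring_mono N(1) by blast
    then have f: "f_one h n ?S k t \<in> absorbs_inverse k (j - 1) j"
      unfolding N(2) using t less.prems True
      by (intro absorbs_inverse_mult_left tail_absorbs_inverse) auto
    have power: "twisted_comm (int p * (- 2 * L t j)) (px t ^ p) (x j) = 0" for p
      using t less.prems by (intro twisted_comm_power_zero px_comm) auto
    have "f_pow h n ?S k t (nat (- B t j)) \<in> absorbs_inverse k (j - 1) j"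
      unfolding f_pow.simps
    proof (intro absorbs_inverse_sum absorbs_inverse_mult_right[OF _ _ power])
      fix i
      show "h powi (- 2 * (int i - 1) * lam ?S t k) * px t ^ (nat (- B t j) - i) * f_one h n ?S k t
          \<in> absorbs_inverse k (j - 1) j"
        using t less.prems f
        by (intro absorbs_inverse_mult_left gen_subring_closed powi_h_in_coeff_ring px_in_coeff_ring) auto
      show "px t ^ (i - 1) \<in> coeff_ring k (j - 1)"
        using t less.prems by (intro gen_subring_closed px_in_coeff_ring) auto
    qed (use less.prems in auto)
    moreover have "twisted_comm (\<Sum>i = t+1..<j. - B i j * (- 2 * L i j))
        (prod_list (map (\<lambda>i. px i powi (- B i j)) [t+1..<j])) (x j) = 0"
    proof (intro twisted_comm_prod_list_zero twisted_comm_powi_zero px_comm)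
      fix i assume "i \<in> {t+1..<j}"
      then show "px i \<noteq> 0 \<or> - B i j \<ge> 0" "1 \<le> i" "i < j"
        using t less.prems B_above[of j i] by auto
    qed (use t in auto)
    ultimately show ?thesis
      using t less.prems
      by (intro absorbs_inverse_mult_right[of _ k "j - 1" j] head_factors_in_coeff_ring) auto
  qed
  then have *: "f_pow h n ?S k t (nat (- B t j)) * prod_list (map (\<lambda>i. px i powi (- B i j)) [t+1..<j]) * inverse (x j)
      \<in> coeff_ring k (j - 1)" if "t \<in> {k..<j}" for t
    using that by (simp add: absorbs_inverse_def)
  have "h powi e * prod_list (map (\<lambda>i. px i powi (- B i j)) [1..<t]) * f_pow h n ?S k t (nat (- B t j))
      * prod_list (map (\<lambda>i. px i powi (- B i j)) [t+1..<j]) * inverse (x j) \<in> coeff_ring k (j - 1)"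
    if t: "t \<in> {k..<j}" for t e
  proof -
    have "h powi e * prod_list (map (\<lambda>i. px i powi (- B i j)) [1..<t]) \<in> coeff_ring k (j - 1)"
      using t less.prems by (intro gen_subring_closed powi_h_in_coeff_ring head_factors_in_coeff_ring) auto
    from gen_subring_mult[OF this *[OF t]] show ?thesis by (simp only: mult.assoc)
  qed
  then show ?case
    unfolding M_one.simps initial_seed_sel by (rule gen_subring_sum)
qed

end

theorem lemma4p3:
  fixes n j k :: nat
    and B L :: "nat \<Rightarrow> nat \<Rightarrow> int"
    and d :: "nat \<Rightarrow> int"
    and h :: "'f::division_ring"
    and X :: "(nat \<Rightarrow> int) \<Rightarrow> 'f"
    and \<Sigma> :: "'f qseed"
  assumes d_pos: "\<forall>i\<in>{1..n}. d i > 0"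
    and skew_symmetrizable: "skew_symmetric_on n (\<lambda>i j. d i * B i j)"
    and principal: "principal_coefficients n B"
    and L_skew: "skew_symmetric_on (2 * n) L"
    and compat: "compatible n d L B"
    and acyclic: "acyclic_exchange n B"
    and ordered: "\<forall>i\<in>{1..n}. \<forall>j\<in>{1..n}. i > j \<longrightarrow> B i j \<ge> 0"
    and skew_field: "quantum_torus_fractions n L h X"
    and seed: "\<Sigma> = initial_seed X L B"
    and j: "j \<in> {1..n}"
    and k: "1 \<le> k" "k < j"
  shows
    "proj_var h n \<Sigma> j * var \<Sigma> k - h powi (- 2 * L j k) * var \<Sigma> k * proj_var h n \<Sigma> j
       = f_one h n \<Sigma> k j \<and>
     f_one h n \<Sigma> k j
       = M_one h n \<Sigma> k j * monom_of h n (iter_seed h n \<Sigma> (j - 1)) (tail_exponent n B j) \<and>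
     M_one h n \<Sigma> k j
       \<in> gen_subring (ZP h n \<Sigma> \<union> proj_var h n \<Sigma> ` {1..j-1} \<union> var \<Sigma> ` {k+1..n})"
proof -
  interpret quantum_torus_fractions n L h X by (rule skew_field)
  interpret ordered_principal_seed n L h X B d
    by unfold_locales (fact d_pos skew_symmetrizable principal L_skew compat ordered)+
  have "f_one h n \<Sigma> k j = M_one h n \<Sigma> k j * monom_of h n (iter_seed h n \<Sigma> (j - 1)) (tail_exponent n B j)"
    using k by (simp add: f_one.simps seed) (simp add: initial_seed_sel)
  moreover have "proj_var h n \<Sigma> j * var \<Sigma> k - h powi (- 2 * L j k) * var \<Sigma> k * proj_var h n \<Sigma> j
      = f_one h n \<Sigma> k j"
    using f_one_eq_comm[of j k] j k by (simp add: seed initial_seed_sel twisted_comm_def)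
  moreover have "M_one h n \<Sigma> k j \<in> gen_subring (ZP h n \<Sigma> \<union> proj_var h n \<Sigma> ` {1..j-1} \<union> var \<Sigma> ` {k+1..n})"
    using M_one_in_coeff_ring[of j k] j k by (simp add: coeff_gens_def seed initial_seed_sel)
  ultimately show ?thesis by blast
qed

end
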